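(* Let $r\ge 2$ and let $\lambda=\alpha_1+\alpha_2+\cdots+\alpha_r$ be the highest root of $\mathfrak{sl}_{r+1}(\mathbb C)$. Then $|\mathcal A(\lambda,0)|=F_r$, where $F_r$ denotes the $r$-th Fibonacci number.
   Context: The simple roots of $\mathfrak{sl}_{r+1}(\mathbb C)$ are $\Delta=\{\alpha_1,\ldots,\alpha_r\}$ and the positive roots are $\Phi^+=\{\alpha_i+\alpha_{i+1}+\cdots+\alpha_j:1\le i\le j\le r\}$. Set $\rho=\frac12\sum_{\alpha\in\Phi^+}\alpha$. The Weyl group $W$ is generated by the simple reflections $s_1,\ldots,s_r$, where $s_i(\alpha_i)=-\alpha_i$, $s_i(\alpha_j)=\alpha_i+\alpha_j$ if $|i-j|=1$, and $s_i(\alpha_j)=\alpha_j$ if $|i-j|>1$. Kostant's partition function $\wp(\xi)$ is the number of ways to write $\xi$ as a nonnegative integral linear combination of positive roots (so $\wp(0)=1$). For weights $\lambda,\mu$, the Weyl alternation set is $\mathcal A(\lambda,\mu)=\{\sigma\in W:\wp(\sigma(\lambda+\rho)-(\mu+\rho))>0\}$. Fibonacci numbers: $F_1=F_2=1$, $F_n=F_{n-1}+F_{n-2}$. *)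

theory Defs
  imports
    Complex_Main
    "HOL-Library.Function_Algebras"
    "HOL-Algebra.Bij"
    "HOL-Algebra.Generated_Groups"
    "HOL-Number_Theory.Fib"
begin

text \<open>
  Weights of type A of rank r are elements of the real span of the simple roots and are represented
  by their coordinates with respect to the simple roots, which are indexed by 1, ..., r.
  Addition, subtraction and 0 are the pointwise operations on functions.
\<close>

type_synonym weight = "nat \<Rightarrow> real"

definition weight_space :: "nat \<Rightarrow> weight set" where
  "weight_space r = {v. \<forall>k. k \<notin> {1..r} \<longrightarrow> v k = 0}"

definition wscale :: "real \<Rightarrow> weight \<Rightarrow> weight"  (infixr \<open>\<cdot>\<^sub>w\<close> 75) where
  "c \<cdot>\<^sub>w v = (\<lambda>k. c * v k)"

definition simple_root :: "nat \<Rightarrow> weight"  (\<open>\<alpha>\<close>) where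
  "\<alpha> i = (\<lambda>k. if k = i then 1 else 0)"

definition positive_roots :: "nat \<Rightarrow> weight set"  (\<open>\<Phi>\<^sup>+\<close>) where
  "\<Phi>\<^sup>+ r = {(\<Sum>k=i..j. \<alpha> k) | i j. 1 \<le> i \<and> i \<le> j \<and> j \<le> r}"

definition weyl_vector :: "nat \<Rightarrow> weight"  (\<open>\<rho>\<close>) where
  "\<rho> r = (1/2) \<cdot>\<^sub>w (\<Sum>\<beta>\<in>\<Phi>\<^sup>+ r. \<beta>)"

definition reflect_simple_root :: "nat \<Rightarrow> nat \<Rightarrow> weight" where
  "reflect_simple_root i j =
     (if j = i then - \<alpha> i else if \<bar>int i - int j\<bar> = 1 then \<alpha> i + \<alpha> j else \<alpha> j)"

text \<open>
  The linear extension of the above to the whole weight space. Since the elements of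
  \<^term>\<open>BijGroup S\<close> are extensional functions, it is undefined outside the weight space.
\<close>

definition simple_reflection :: "nat \<Rightarrow> nat \<Rightarrow> weight \<Rightarrow> weight" where
  "simple_reflection r i = (\<lambda>v\<in>weight_space r. \<Sum>j=1..r. v j \<cdot>\<^sub>w reflect_simple_root i j)"

definition weyl_group :: "nat \<Rightarrow> (weight \<Rightarrow> weight) set" where
  "weyl_group r = generate (BijGroup (weight_space r)) (simple_reflection r ` {1..r})"

text \<open>
  The coefficient functions are extensional, so each of them is counted only once. There are
  always finitely many of them, because every positive root has nonnegative coordinates, not all zero.
\<close>

definition kostant_partition :: "nat \<Rightarrow> weight \<Rightarrow> nat"  (\<open>\<wp>\<close>) where
  "\<wp> r \<xi> = card {c \<in> \<Phi>\<^sup>+ r \<rightarrow>\<^sub>E (UNIV :: nat set). (\<Sum>\<beta>\<in>\<Phi>\<^sup>+ r. real (c \<beta>) \<cdot>\<^sub>w \<beta>) = \<xi>}"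

definition weyl_alternation_set :: "nat \<Rightarrow> weight \<Rightarrow> weight \<Rightarrow> (weight \<Rightarrow> weight) set"  (\<open>\<A>\<close>) where
  "\<A> r lam mu = {\<sigma> \<in> weyl_group r. \<wp> r (\<sigma> (lam + \<rho> r) - (mu + \<rho> r)) > 0}"


lemma sum_weight_apply: "(\<Sum>x\<in>A. f x) k = (\<Sum>x\<in>A. (f x :: weight) k)"
  by (induction A rule: infinite_finite_induct) auto

lemma simple_reflection_simple_root:
  assumes "j \<in> {1..r}"
  shows "simple_reflection r i (\<alpha> j) = reflect_simple_root i j"
proof
  fix k
  have mem: "\<alpha> j \<in> weight_space r"
    using assms by (auto simp: weight_space_def simple_root_def)
  have "simple_reflection r i (\<alpha> j) k = (\<Sum>l=1..r. \<alpha> j l * reflect_simple_root i l k)"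
    using mem by (simp add: simple_reflection_def sum_weight_apply wscale_def)
  also have "\<dots> = (\<Sum>l=1..r. if l = j then reflect_simple_root i l k else 0)"
    by (rule sum.cong) (auto simp: simple_root_def)
  also have "\<dots> = reflect_simple_root i j k"
    using assms by simp
  finally show "simple_reflection r i (\<alpha> j) k = reflect_simple_root i j k" .
qed

lemma simple_reflection_coordinates:
  assumes i: "i \<in> {1..r}" and v: "v \<in> weight_space r"
  shows "simple_reflection r i v = v(i := v (i - 1) + v (i + 1) - v i)"
proof
  fix k
  have v0: "v l = 0" if "l \<notin> {1..r}" for l
    using v that by (auto simp: weight_space_def)
  have "simple_reflection r i v k = (\<Sum>l=1..r. v l * reflect_simple_root i l k)"
    using v by (simp add: simple_reflection_def sum_weight_apply wscale_def)
  also have "\<dots> = (\<Sum>l=1..r. (if l = k then (if k = i then - v l else v l) else 0)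
                      + ((if l = i - 1 \<and> k = i then v l else 0) + (if l = i + 1 \<and> k = i then v l else 0)))"
    by (rule sum.cong) (use i in \<open>auto simp: reflect_simple_root_def simple_root_def\<close>)
  also have "\<dots> = (if k = i then - v k else v k)
                  + ((if k = i then v (i - 1) else 0) + (if k = i then v (i + 1) else 0))"
    using v0[of k] v0[of "i - 1"] v0[of "i + 1"] by (cases "k = i") (auto simp: sum.distrib)
  finally show "simple_reflection r i v k = (v(i := v (i - 1) + v (i + 1) - v i)) k"
    by simp
qed

lemma simple_reflection_closed:
  assumes "i \<in> {1..r}" and "v \<in> weight_space r"
  shows "simple_reflection r i v \<in> weight_space r"
  using assms by (auto simp: simple_reflection_coordinates weight_space_def)

lemma simple_reflection_involution:
  assumes "i \<in> {1..r}" and "v \<in> weight_space r"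
  shows "simple_reflection r i (simple_reflection r i v) = v"
proof -
  have "i - 1 \<noteq> i" using assms(1) by auto
  then show ?thesis
    using simple_reflection_coordinates[OF assms]
      simple_reflection_coordinates[OF assms(1) simple_reflection_closed[OF assms]]
    by auto
qed

lemma simple_reflection_in_BijGroup:
  assumes "i \<in> {1..r}"
  shows "simple_reflection r i \<in> carrier (BijGroup (weight_space r))"
proof -
  have "bij_betw (simple_reflection r i) (weight_space r) (weight_space r)"
    by (rule bij_betw_byWitness[where f' = "simple_reflection r i"])
       (use assms in \<open>auto simp: simple_reflection_closed simple_reflection_involution\<close>)
  moreover have "simple_reflection r i \<in> extensional (weight_space r)"
    by (simp add: simple_reflection_def)
  ultimately show ?thesis
    by (simp add: BijGroup_def Bij_def)
qed

lemma weyl_group_subgroup: "subgroup (weyl_group r) (BijGroup (weight_space r))"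
  unfolding weyl_group_def
  by (rule group.generate_is_subgroup[OF group_BijGroup])
     (auto intro: simple_reflection_in_BijGroup)

end

theory Submission
  imports Defs "HOL-Combinatorics.Permutations"
begin

text \<open>
  A weight \<open>v\<close> is determined by the differences \<open>v j - v (j - 1)\<close> for \<open>1 \<le> j \<le> r + 1\<close>, its coordinates in
  the standard basis of the ambient space of dimension \<open>r + 1\<close>, and \<open>v k\<close> is the sum of the first
  \<open>k\<close> of them. In these terms the simple reflection \<open>s\<^sub>i\<close> exchanges the entries \<open>i\<close> and \<open>i + 1\<close>, so
  every Weyl group element permutes the entries (\<open>weyl_group_imp_perm_action\<close>).

  Up to the additive constant \<open>r/2 + 1\<close>, the entries of \<open>\<rho>\<close> are \<open>-1, -2, \<dots>, -(r + 1)\<close>, and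
  those of \<open>\<lambda> + \<rho>\<close> are \<open>0, -2, -3, \<dots>, -r, -(r + 2)\<close>. Simple roots are positive roots and all positive
  roots have nonnegative coordinates, so an integral weight has a positive partition number iff its
  coordinates with respect to the simple roots are nonnegative
  (\<open>kostant_partition_pos_iff\<close>). Thus the alternation set consists of the rearrangements of
  \<open>0, 2, 3, \<dots>, r, r + 2\<close> whose \<open>k\<close>-th partial sum is at most \<open>1 + 2 + \<dots> + k\<close> for all
  \<open>k \<le> r\<close>. The condition for \<open>k = 1\<close> puts \<open>0\<close> in front. The sum of all entries is
  \<open>1 + \<dots> + (r + 1)\<close>, so the condition for \<open>k = r\<close> says that the last entry is at least \<open>r + 1\<close>,
  hence it is \<open>r + 2\<close>. What is left is a permutation of \<open>2, \<dots>, r\<close> whose partial sums exceed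
  those of the identity by at most \<open>1\<close> (\<open>dominated_prefix_sums_iff\<close>).

  The same comparison with the total, applied to the last entries of such a permutation, shows that
  it either fixes the largest number or exchanges it with its predecessor; in both cases a shorter
  permutation of the same kind remains (\<open>slack_perms_rec\<close>). This is the Fibonacci recursion. It also
  exhibits these permutations as products of adjacent transpositions, which is why the corresponding
  maps lie in the Weyl group (\<open>slack_perms_weyl_group\<close>), and distinct permutations give distinct maps
  because the entries of \<open>\<rho>\<close> are pairwise different (\<open>inj_on_perm_action\<close>).
\<close>

section \<open>Permutations whose partial sums barely exceed those of the identity\<close>

text \<open>
  Letting \<open>k\<close> range over all numbers costs nothing, since from \<open>n\<close> on the partial sums agree with
  those of the identity. It makes the second condition independent of \<open>n\<close>, so that the sets grow with \<open>n\<close>.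
\<close>

definition slack_perms :: "nat \<Rightarrow> nat \<Rightarrow> (nat \<Rightarrow> nat) set" where
  "slack_perms m n = {p. p permutes {m..<n} \<and> (\<forall>k. (\<Sum>j=m..<k. p j) \<le> Suc (\<Sum>j=m..<k. j))}"

lemma sum_permuted_prefix:
  fixes m n k :: nat
  assumes "p permutes {m..<n}" "n \<le> k"
  shows "(\<Sum>j=m..<k. f (p j)) = (\<Sum>j=m..<k. f j)"
proof -
  have "{m..<n} \<subseteq> {m..<k}" using assms(2) by auto
  then have "p permutes {m..<k}" by (rule permutes_subset[OF assms(1)])
  from sum.permute[OF this, of f] show ?thesis by (simp add: o_def)
qed

lemma slack_perms_trivial:
  assumes "n \<le> Suc m"
  shows "slack_perms m n = {id}"
proof -
  have "{m..<n} = {} \<or> {m..<n} = {m}"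
    using assms by (cases "n \<le> m") (auto simp: le_Suc_eq)
  then show ?thesis
    by (auto simp: slack_perms_def)
qed

text \<open>
  Only the partial sum that ends between \<open>n\<close> and \<open>n + 1\<close> sees the added transposition. There \<open>q\<close> has
  no excess of its own, having used up exactly the numbers below \<open>n\<close>, so the total excess is \<open>1\<close>.
\<close>

lemma slack_perms_append_transposition:
  assumes q: "q \<in> slack_perms m n" and mn: "m \<le> n"
  shows "transpose n (Suc n) \<circ> q \<in> slack_perms m (Suc (Suc n))"
proof -
  let ?t = "transpose n (Suc n)"
  have qp: "q permutes {m..<n}" and qs: "\<And>k. (\<Sum>j=m..<k. q j) \<le> Suc (\<Sum>j=m..<k. j)"
    using q by (auto simp: slack_perms_def)
  have "q permutes {m..<Suc (Suc n)}"
    by (rule permutes_subset[OF qp]) auto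
  moreover have "?t permutes {m..<Suc (Suc n)}"
    using mn by (intro permutes_swap_id) auto
  ultimately have p: "(?t \<circ> q) permutes {m..<Suc (Suc n)}"
    by (rule permutes_compose)
  have qin: "q j \<in> {m..<n}" if "j \<in> {m..<n}" for j
    using permutes_in_image[OF qp] that by blast
  have low: "(\<Sum>j=m..<k. (?t \<circ> q) j) = (\<Sum>j=m..<k. q j)" if "k \<le> n" for k
  proof (rule sum.cong[OF refl])
    fix j assume "j \<in> {m..<k}"
    then have "q j \<in> {m..<n}" using qin that by auto
    then show "(?t \<circ> q) j = q j" by (simp add: transpose_def)
  qed
  have "(\<Sum>j=m..<k. (?t \<circ> q) j) \<le> Suc (\<Sum>j=m..<k. j)" for k
  proof -
    consider "k \<le> n" | "k = Suc n" | "Suc (Suc n) \<le> k" by linarith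
    then show ?thesis
    proof cases
      case 1 then show ?thesis using low qs by simp
    next
      case 2
      have "q n = n" using qp by (simp add: permutes_def)
      then have "(\<Sum>j=m..<k. (?t \<circ> q) j) = (\<Sum>j=m..<n. q j) + Suc n"
        using 2 mn low[of n] by simp
      also have "(\<Sum>j=m..<n. q j) = (\<Sum>j=m..<n. j)"
        using sum_permuted_prefix[OF qp order_refl, of "\<lambda>x. x"] by simp
      finally show ?thesis using 2 mn by simp
    next
      case 3
      then show ?thesis using sum_permuted_prefix[OF p, of k "\<lambda>x. x"] by simp
    qed
  qed
  with p show ?thesis by (simp add: slack_perms_def)
qed

lemma slack_perms_mono: "n \<le> n' \<Longrightarrow> slack_perms m n \<subseteq> slack_perms m n'"
  unfolding slack_perms_def by (auto elim: permutes_subset)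

text \<open>
  All values together have the same sum as for the identity, so an excess of at most \<open>1\<close> before the
  last position means a deficit of at most \<open>1\<close> at the last position.
\<close>

lemma slack_perms_last:
  assumes p: "p \<in> slack_perms m (Suc n)" and mn: "m \<le> n"
  shows "n \<le> Suc (p n)"
proof -
  have "(\<Sum>j=m..<n. p j) \<le> Suc (\<Sum>j=m..<n. j)" and pp: "p permutes {m..<Suc n}"
    using p by (auto simp: slack_perms_def)
  moreover have "(\<Sum>j=m..<n. p j) + p n = (\<Sum>j=m..<n. j) + n"
    using sum_permuted_prefix[OF pp order_refl, of "\<lambda>x. x"] mn by simp
  ultimately show ?thesis by linarith
qed

lemma slack_perms_fix_last:
  assumes p: "p \<in> slack_perms m (Suc n)" and "p n = n"
  shows "p \<in> slack_perms m n"
proof -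
  have "p permutes {m..<n}"
    by (rule permutes_superset[of p "{m..<Suc n}"]) (use assms in \<open>auto simp: slack_perms_def less_Suc_eq\<close>)
  with p show ?thesis by (simp add: slack_perms_def)
qed

text \<open>
  The excess of \<open>1\<close> is already spent by the value \<open>n\<close> in the last position. Comparing the partial sum
  before the last two positions with the total therefore forces \<open>p n \<ge> n\<close>, and as the value \<open>n\<close> is
  taken, \<open>p n = n + 1\<close>. So \<open>p\<close> exchanges the two largest numbers.
\<close>

lemma slack_perms_drop_transposition:
  assumes p: "p \<in> slack_perms m (Suc (Suc n))" and mn: "m \<le> n" and last: "p (Suc n) = n"
  shows "transpose n (Suc n) \<circ> p \<in> slack_perms m n"
proof -
  let ?t = "transpose n (Suc n)"
  have pp: "p permutes {m..<Suc (Suc n)}" and ps: "\<And>k. (\<Sum>j=m..<k. p j) \<le> Suc (\<Sum>j=m..<k. j)"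
    using p by (auto simp: slack_perms_def)
  have "(\<Sum>j=m..<n. p j) + p n + n = (\<Sum>j=m..<n. j) + n + Suc n"
    using sum_permuted_prefix[OF pp order_refl, of "\<lambda>x. x"] mn last by simp
  then have "n \<le> p n" using ps[of n] by linarith
  moreover have "p n \<noteq> n"
    using last permutes_inj[OF pp] by (metis injD n_not_Suc_n)
  moreover have "p n \<in> {m..<Suc (Suc n)}"
    using permutes_in_image[OF pp, of n] mn by auto
  ultimately have pn: "p n = Suc n" by auto
  have "?t permutes {m..<Suc (Suc n)}"
    using mn by (intro permutes_swap_id) auto
  then have tp: "(?t \<circ> p) permutes {m..<Suc (Suc n)}"
    using pp by (rule permutes_compose[rotated])
  have q: "(?t \<circ> p) permutes {m..<n}"
    by (rule permutes_superset[OF tp]) (use last pn in \<open>auto simp: less_Suc_eq\<close>)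
  have "(\<Sum>j=m..<k. (?t \<circ> p) j) \<le> Suc (\<Sum>j=m..<k. j)" for k
  proof (cases "k \<le> n")
    case True
    have "(\<Sum>j=m..<k. (?t \<circ> p) j) = (\<Sum>j=m..<k. p j)"
    proof (rule sum.cong[OF refl])
      fix j assume j: "j \<in> {m..<k}"
      then have "p j \<noteq> p n" "p j \<noteq> p (Suc n)"
        using True permutes_inj[OF pp] by (auto dest!: injD)
      then show "(?t \<circ> p) j = p j" using pn last by (simp add: transpose_def)
    qed
    then show ?thesis using ps by simp
  next
    case False
    then show ?thesis using sum_permuted_prefix[OF q, of k "\<lambda>x. x"] by simp
  qed
  with q show ?thesis by (simp add: slack_perms_def)
qed

lemma slack_perms_rec:
  assumes mn: "m \<le> n"
  shows "slack_perms m (Suc (Suc n))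
       = slack_perms m (Suc n) \<union> (\<lambda>q. transpose n (Suc n) \<circ> q) ` slack_perms m n"
    (is "?L = ?A \<union> ?f ` ?B")
proof
  show "?A \<union> ?f ` ?B \<subseteq> ?L"
    using slack_perms_mono[of "Suc n" "Suc (Suc n)" m] slack_perms_append_transposition[OF _ mn] by auto
  show "?L \<subseteq> ?A \<union> ?f ` ?B"
  proof
    fix p assume p: "p \<in> ?L"
    have "Suc n \<le> Suc (p (Suc n))"
      using slack_perms_last[OF p] mn by simp
    moreover have "p (Suc n) < Suc (Suc n)"
      using p permutes_in_image[of p "{m..<Suc (Suc n)}" "Suc n"] mn by (auto simp: slack_perms_def)
    ultimately consider "p (Suc n) = Suc n" | "p (Suc n) = n" by linarith
    then show "p \<in> ?A \<union> ?f ` ?B"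
    proof cases
      case 1 then show ?thesis using slack_perms_fix_last[OF p] by simp
    next
      case 2
      have "p = ?f (?f p)" by (simp add: fun_eq_iff)
      then show ?thesis using slack_perms_drop_transposition[OF p mn 2] by blast
    qed
  qed
qed

lemma slack_perms_fixes: "p \<in> slack_perms m n \<Longrightarrow> n \<le> k \<Longrightarrow> p k = k"
  by (simp add: slack_perms_def permutes_def)

lemma finite_slack_perms: "finite (slack_perms m n)"
  by (rule finite_subset[OF _ finite_permutations[of "{m..<n}"]]) (auto simp: slack_perms_def)

lemma card_slack_perms: "card (slack_perms m (m + d)) = fib (Suc d)"
proof (induction d rule: fib.induct)
  case 1 then show ?case by (simp add: slack_perms_trivial)
next
  case 2 then show ?case by (simp add: slack_perms_trivial)
next
  case (3 d)
  let ?n = "m + d"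
  let ?f = "\<lambda>q. transpose ?n (Suc ?n) \<circ> q"
  have inj: "inj_on ?f (slack_perms m ?n)"
    by (rule inj_on_inverseI[where g = ?f]) (simp add: fun_eq_iff)
  have disj: "slack_perms m (Suc ?n) \<inter> ?f ` slack_perms m ?n = {}"
  proof (intro equals0I, elim IntE imageE)
    fix p q assume "p \<in> slack_perms m (Suc ?n)" "q \<in> slack_perms m ?n" "p = ?f q"
    then show False
      using slack_perms_fixes[of p m "Suc ?n" "Suc ?n"] slack_perms_fixes[of q m ?n "Suc ?n"] by simp
  qed
  have "card (slack_perms m (Suc (Suc ?n)))
      = card (slack_perms m (Suc ?n)) + card (slack_perms m ?n)"
    using slack_perms_rec[of m ?n] card_Un_disjoint[OF _ _ disj] finite_slack_perms card_image[OF inj]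
    by simp
  then show ?case using 3 by simp
qed

section \<open>The Weyl group as permutations of the differences of coordinates\<close>

definition eps_coord :: "weight \<Rightarrow> nat \<Rightarrow> real" where
  "eps_coord v j = v j - v (j - 1)"

text \<open>
  The coordinates are the partial sums of the permuted differences. If \<open>p\<close> permutes \<open>{1..r + 1}\<close>, these
  vanish by themselves for \<open>k > r\<close>. The map is extensional, as the elements of \<^const>\<open>BijGroup\<close> are.
\<close>

definition perm_action :: "nat \<Rightarrow> (nat \<Rightarrow> nat) \<Rightarrow> weight \<Rightarrow> weight" where
  "perm_action r p = (\<lambda>v\<in>weight_space r. \<lambda>k. \<Sum>j=1..k. eps_coord v (p j))"

lemma sum_eps_coord: "v \<in> weight_space r \<Longrightarrow> (\<Sum>j=1..k. eps_coord v j) = v k"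
  by (induction k) (auto simp: eps_coord_def weight_space_def)

lemma sum_eps_coord_permuted:
  assumes v: "v \<in> weight_space r" and p: "p permutes {1..n}" and "n \<le> k"
  shows "(\<Sum>j=1..k. eps_coord v (p j)) = v k"
  using sum_permuted_prefix[of p 1 "Suc n" "Suc k" "eps_coord v"] p \<open>n \<le> k\<close> sum_eps_coord[OF v]
  by (simp add: atLeastLessThanSuc_atLeastAtMost)

lemma perm_action_closed:
  assumes p: "p permutes {1..Suc r}" and v: "v \<in> weight_space r"
  shows "perm_action r p v \<in> weight_space r"
  using v sum_eps_coord_permuted[OF v p] by (auto simp: perm_action_def weight_space_def not_le Suc_le_eq)

lemma perm_action_id: "perm_action r id = (\<lambda>v\<in>weight_space r. v)"
  by (auto simp: perm_action_def sum_eps_coord fun_eq_iff simp del: One_nat_def)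

lemma eps_coord_perm_action:
  assumes "v \<in> weight_space r" "j \<ge> 1"
  shows "eps_coord (perm_action r p v) j = eps_coord v (p j)"
  using assms by (cases j) (auto simp: eps_coord_def[of "perm_action r p v"]
      eps_coord_def[of "\<lambda>k. _ k"] perm_action_def)

text \<open>
  The order is reversed, because \<open>p\<close> acts on positions: entry \<open>j\<close> of the image of \<open>v\<close> is entry \<open>p j\<close>
  of \<open>v\<close>.
\<close>

lemma perm_action_compose:
  assumes p: "p permutes {1..Suc r}" and q: "q permutes {1..Suc r}"
  shows "compose (weight_space r) (perm_action r p) (perm_action r q) = perm_action r (q \<circ> p)"
proof
  fix v
  have pos: "p j \<ge> 1" if "j \<ge> 1" for j
    using permutes_in_image[OF p, of j] permutes_not_in[OF p, of j] that by (cases "j \<le> Suc r") auto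
  show "compose (weight_space r) (perm_action r p) (perm_action r q) v = perm_action r (q \<circ> p) v"
  proof (cases "v \<in> weight_space r")
    case True
    then have "perm_action r p (perm_action r q v) = perm_action r (q \<circ> p) v"
      using perm_action_closed[OF q True] pos
      by (simp add: perm_action_def[of r p] perm_action_def[of r "q \<circ> p"] eps_coord_perm_action
          del: One_nat_def)
    with True show ?thesis by (simp add: compose_def)
  qed (simp add: compose_def perm_action_def)
qed

text \<open>
  Exchanging two adjacent differences changes only the partial sum that separates them, which becomes
  \<open>v (i - 1) + (v (i + 1) - v i)\<close>.
\<close>

lemma perm_action_adjacent_transposition:
  assumes i: "i \<in> {1..r}"
  shows "perm_action r (transpose i (Suc i)) = simple_reflection r i"
proof
  fix v
  let ?t = "transpose i (Suc i)"
  show "perm_action r ?t v = simple_reflection r i v"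
  proof (cases "v \<in> weight_space r")
    case True
    have "(\<Sum>j=1..k. eps_coord v (?t j)) = (v(i := v (i - 1) + v (i + 1) - v i)) k" for k
    proof -
      have low: "(\<Sum>j=1..k. eps_coord v (?t j)) = v k" if "k < i" for k
      proof -
        have "(\<Sum>j=1..k. eps_coord v (?t j)) = (\<Sum>j=1..k. eps_coord v j)"
          by (rule sum.cong) (use that in \<open>auto simp: transpose_def\<close>)
        then show ?thesis using sum_eps_coord[OF True] by simp
      qed
      consider "k < i" | "k = i" | "Suc i \<le> k" by linarith
      then show ?thesis
      proof cases
        case 1 then show ?thesis using low by simp
      next
        case 2
        then have "(\<Sum>j=1..k. eps_coord v (?t j)) = v (i - 1) + eps_coord v (Suc i)"
          using low[of "i - 1"] i by (cases i) auto
        then show ?thesis using 2 by (simp add: eps_coord_def)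
      next
        case 3
        have "?t permutes {1..Suc i}" using i by (intro permutes_swap_id) auto
        with 3 show ?thesis using sum_eps_coord_permuted[OF True, of ?t "Suc i" k] by simp
      qed
    qed
    then show ?thesis
      using True by (simp add: perm_action_def simple_reflection_coordinates[OF i True] fun_eq_iff)
  qed (simp add: perm_action_def simple_reflection_def)
qed

lemma mult_BijGroup:
  "f \<in> carrier (BijGroup S) \<Longrightarrow> g \<in> carrier (BijGroup S) \<Longrightarrow> f \<otimes>\<^bsub>BijGroup S\<^esub> g = compose S f g"
  by (simp add: BijGroup_def)

lemma weyl_group_carrier: "\<sigma> \<in> weyl_group r \<Longrightarrow> \<sigma> \<in> carrier (BijGroup (weight_space r))"
  using weyl_group_subgroup by (rule subgroup.mem_carrier)

lemma inv_simple_reflection: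
  assumes i: "i \<in> {1..r}"
  shows "inv\<^bsub>BijGroup (weight_space r)\<^esub> (simple_reflection r i) = simple_reflection r i"
proof -
  interpret group "BijGroup (weight_space r)" by (rule group_BijGroup)
  have "simple_reflection r i \<otimes>\<^bsub>BijGroup (weight_space r)\<^esub> simple_reflection r i
      = (\<lambda>v\<in>weight_space r. v)"
    using i by (simp add: mult_BijGroup simple_reflection_in_BijGroup compose_def restrict_def
        simple_reflection_involution fun_eq_iff)
  then show ?thesis
    using simple_reflection_in_BijGroup[OF i] by (intro inv_equality) (simp_all add: BijGroup_def)
qed

lemma weyl_group_imp_perm_action:
  assumes "\<sigma> \<in> weyl_group r"
  shows "\<exists>p. p permutes {1..Suc r} \<and> \<sigma> = perm_action r p"
proof -
  have gen: "\<exists>p. p permutes {1..Suc r} \<and> simple_reflection r i = perm_action r p"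
    if i: "i \<in> {1..r}" for i
    using perm_action_adjacent_transposition[OF i, symmetric] i
    by (intro exI[of _ "transpose i (Suc i)"] conjI permutes_swap_id) auto
  show ?thesis
    using assms[unfolded weyl_group_def]
  proof (induction rule: generate.induct)
    case one
    then show ?case
      by (intro exI[of _ id]) (simp add: BijGroup_def perm_action_id permutes_id del: id_apply)
  next
    case (incl h)
    then show ?case using gen by auto
  next
    case (inv h)
    then show ?case using gen by (auto simp: inv_simple_reflection)
  next
    case (eng h1 h2)
    then have "h1 \<otimes>\<^bsub>BijGroup (weight_space r)\<^esub> h2 = compose (weight_space r) h1 h2"
      by (intro mult_BijGroup weyl_group_carrier) (simp_all add: weyl_group_def)
    then show ?case
      using eng.IH perm_action_compose permutes_compose by metis
  qed
qed

lemma slack_perms_permutes: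
  assumes "p \<in> slack_perms m n" "m \<ge> 1" "n \<le> Suc (Suc r)"
  shows "p permutes {1..Suc r}"
  by (rule permutes_subset[of p "{m..<n}"]) (use assms in \<open>auto simp: slack_perms_def\<close>)

text \<open>
  By their recursion these permutations are products of adjacent transpositions, which act as simple
  reflections.
\<close>

lemma slack_perms_weyl_group:
  assumes "p \<in> slack_perms m (m + d)" "m \<ge> 1" "m + d \<le> Suc (Suc r)"
  shows "perm_action r p \<in> weyl_group r"
proof -
  have identity: "perm_action r id \<in> weyl_group r"
    using subgroup.one_closed[OF weyl_group_subgroup] by (simp add: BijGroup_def perm_action_id)
  show ?thesis
    using assms
  proof (induction d arbitrary: p rule: fib.induct)
    case 3: (3 d)
    interpret subgroup "weyl_group r" "BijGroup (weight_space r)" by (rule weyl_group_subgroup)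
    let ?t = "transpose (m + d) (Suc (m + d))"
    from 3(3) consider "p \<in> slack_perms m (m + Suc d)"
      | q where "q \<in> slack_perms m (m + d)" "p = ?t \<circ> q"
      using slack_perms_rec[of m "m + d"] by auto
    then show ?case
    proof cases
      case 1 then show ?thesis using 3 by simp
    next
      case 2
      have i: "m + d \<in> {1..r}" using 3 by simp
      have q: "perm_action r q \<in> weyl_group r" using 3 2 by simp
      have t: "perm_action r ?t \<in> weyl_group r"
        using i by (simp add: perm_action_adjacent_transposition weyl_group_def generate.incl)
      have "perm_action r p = compose (weight_space r) (perm_action r q) (perm_action r ?t)"
        using 2 slack_perms_permutes[OF 2(1)] 3 i
        by (subst perm_action_compose) (auto intro: permutes_swap_id)
      also have "\<dots> = perm_action r q \<otimes>\<^bsub>BijGroup (weight_space r)\<^esub> perm_action r ?t"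
        using q t by (simp add: mult_BijGroup weyl_group_carrier)
      finally show ?thesis using q t by simp
    qed
  qed (use identity in \<open>auto simp: slack_perms_trivial\<close>)
qed

section \<open>Positive roots, Kostant's partition function and the Weyl vector\<close>

lemma root_coordinates: "(\<Sum>l=i..j. \<alpha> l) k = (if i \<le> k \<and> k \<le> j then 1 else 0)"
  by (simp add: sum_weight_apply simple_root_def)

lemma positive_roots_image:
  "\<Phi>\<^sup>+ r = (\<lambda>(i, j). \<Sum>l=i..j. \<alpha> l) ` {(i, j). 1 \<le> i \<and> i \<le> j \<and> j \<le> r}"
  by (auto simp: positive_roots_def)

lemma finite_root_indices: "finite {(i, j). 1 \<le> i \<and> i \<le> j \<and> j \<le> (r::nat)}"
  by (rule finite_subset[of _ "{..r} \<times> {..r}"]) auto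

lemma finite_positive_roots: "finite (\<Phi>\<^sup>+ r)"
  unfolding positive_roots_image by (rule finite_imageI[OF finite_root_indices])

lemma positive_root_nonneg: "\<beta> \<in> \<Phi>\<^sup>+ r \<Longrightarrow> \<beta> k \<ge> 0"
  by (auto simp: positive_roots_def root_coordinates)

lemma positive_root_outside: "\<beta> \<in> \<Phi>\<^sup>+ r \<Longrightarrow> k \<notin> {1..r} \<Longrightarrow> \<beta> k = 0"
  by (auto simp: positive_roots_def root_coordinates)

lemma positive_root_support: "\<beta> \<in> \<Phi>\<^sup>+ r \<Longrightarrow> \<exists>k\<in>{1..r}. \<beta> k = 1"
  unfolding positive_roots_def by (force simp: root_coordinates)

lemma simple_root_positive: "i \<in> {1..r} \<Longrightarrow> \<alpha> i \<in> \<Phi>\<^sup>+ r"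
  unfolding positive_roots_def by (force intro: exI[of _ i])

lemma inj_on_root: "inj_on (\<lambda>(i, j). \<Sum>l=i..j. \<alpha> l) {(i, j). 1 \<le> i \<and> i \<le> j \<and> j \<le> r}"
proof (rule inj_onI, clarify)
  fix i j i' j' :: nat
  assume le: "i \<le> j" "i' \<le> j'" and eq: "(\<Sum>l=i..j. \<alpha> l) = (\<Sum>l=i'..j'. \<alpha> l)"
  have "k \<in> {i..j} \<longleftrightarrow> k \<in> {i'..j'}" for k
    using fun_cong[OF eq, of k] by (auto simp: root_coordinates split: if_splits)
  then have "{i..j} = {i'..j'}" by blast
  with le show "i = i' \<and> j = j'" by auto
qed

text \<open>
  The coordinate \<open>k\<close> of a positive root \<open>\<alpha>\<^sub>i + \<dots> + \<alpha>\<^sub>j\<close> is \<open>1\<close> when \<open>1 \<le> i \<le> k \<le> j \<le> r\<close> and \<open>0\<close> otherwise,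
  so coordinate \<open>k\<close> of \<open>2\<rho>\<close> counts \<open>k\<close> choices of \<open>i\<close> times \<open>r + 1 - k\<close> choices of \<open>j\<close>.
  The formula also gives the correct value \<open>0\<close> at the two ends \<open>k = 0\<close> and \<open>k = r + 1\<close>.
\<close>

lemma weyl_vector_coordinates:
  assumes "k \<le> Suc r"
  shows "\<rho> r k = real k * (real r + 1 - real k) / 2"
proof -
  have "(\<Sum>\<beta>\<in>\<Phi>\<^sup>+ r. \<beta> k) = (\<Sum>(i, j) | 1 \<le> i \<and> i \<le> j \<and> j \<le> r. (\<Sum>l=i..j. \<alpha> l) k)"
    unfolding positive_roots_image by (subst sum.reindex[OF inj_on_root]) (simp add: case_prod_unfold)
  also have "\<dots> = (\<Sum>x | 1 \<le> fst x \<and> fst x \<le> snd x \<and> snd x \<le> r. if x \<in> {1..k} \<times> {k..r} then 1 else 0)"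
    by (rule sum.cong) (auto simp: root_coordinates split: if_splits)
  also have "\<dots> = real (card ({x. 1 \<le> fst x \<and> fst x \<le> snd x \<and> snd x \<le> r} \<inter> {1..k} \<times> {k..r}))"
    using finite_root_indices[of r] by (subst sum.inter_restrict[symmetric]) (auto simp: case_prod_unfold)
  also have "{x. 1 \<le> fst x \<and> fst x \<le> snd x \<and> snd x \<le> r} \<inter> {1..k} \<times> {k..r} = {1..k} \<times> {k..r}"
    by auto
  also have "real (card ({1..k} \<times> {k..r})) = real k * (real r + 1 - real k)"
    using assms by (simp add: of_nat_diff)
  finally show ?thesis by (simp add: weyl_vector_def wscale_def sum_weight_apply)
qed

lemma weyl_vector_weight_space: "\<rho> r \<in> weight_space r"
  by (auto simp: weight_space_def weyl_vector_def wscale_def sum_weight_apply positive_root_outside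
      intro!: sum.neutral)

lemma eps_coord_weyl_vector:
  assumes "j \<in> {1..Suc r}"
  shows "eps_coord (\<rho> r) j = real r / 2 + 1 - real j"
  using assms by (cases j) (auto simp: eps_coord_def weyl_vector_coordinates field_simps)

text \<open>
  Every positive root has a coordinate equal to \<open>1\<close> and all terms are nonnegative, so a coefficient is
  at most the corresponding coordinate of \<open>\<xi>\<close>. Finiteness matters because \<^const>\<open>card\<close> of an infinite
  set is \<open>0\<close>.
\<close>

lemma finite_kostant_decompositions:
  "finite {c \<in> \<Phi>\<^sup>+ r \<rightarrow>\<^sub>E (UNIV :: nat set). (\<Sum>\<beta>\<in>\<Phi>\<^sup>+ r. real (c \<beta>) \<cdot>\<^sub>w \<beta>) = \<xi>}"
proof -
  let ?N = "nat \<lceil>\<Sum>k=1..r. \<bar>\<xi> k\<bar>\<rceil>"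
  have "c \<beta> \<le> ?N" if eq: "(\<Sum>\<beta>\<in>\<Phi>\<^sup>+ r. real (c \<beta>) \<cdot>\<^sub>w \<beta>) = \<xi>" and \<beta>: "\<beta> \<in> \<Phi>\<^sup>+ r" for c \<beta>
  proof -
    obtain k where k: "k \<in> {1..r}" "\<beta> k = 1" using positive_root_support[OF \<beta>] by blast
    have "real (c \<beta>) = real (c \<beta>) * \<beta> k" using k by simp
    also have "\<dots> \<le> (\<Sum>\<gamma>\<in>\<Phi>\<^sup>+ r. real (c \<gamma>) * \<gamma> k)"
      by (rule member_le_sum[OF \<beta>]) (auto simp: positive_root_nonneg finite_positive_roots)
    also have "\<dots> = \<xi> k" by (simp add: eq[symmetric] sum_weight_apply wscale_def)
    also have "\<dots> \<le> \<bar>\<xi> k\<bar>" by simp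
    also have "\<dots> \<le> (\<Sum>k=1..r. \<bar>\<xi> k\<bar>)"
      using k by (intro member_le_sum) auto
    finally show ?thesis by linarith
  qed
  then have "{c \<in> \<Phi>\<^sup>+ r \<rightarrow>\<^sub>E UNIV. (\<Sum>\<beta>\<in>\<Phi>\<^sup>+ r. real (c \<beta>) \<cdot>\<^sub>w \<beta>) = \<xi>} \<subseteq> \<Phi>\<^sup>+ r \<rightarrow>\<^sub>E {..?N}"
    by (auto simp: PiE_iff extensional_def)
  then show ?thesis
    by (rule finite_subset) (simp add: finite_PiE finite_positive_roots)
qed

lemma kostant_partition_pos_iff:
  assumes \<xi>: "\<xi> \<in> weight_space r" and int: "\<And>k. \<xi> k \<in> \<int>"
  shows "\<wp> r \<xi> > 0 \<longleftrightarrow> (\<forall>k\<in>{1..r}. \<xi> k \<ge> 0)"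
proof
  assume "\<wp> r \<xi> > 0"
  then obtain c where eq: "(\<Sum>\<beta>\<in>\<Phi>\<^sup>+ r. real (c \<beta>) \<cdot>\<^sub>w \<beta>) = \<xi>"
    unfolding kostant_partition_def card_gt_0_iff by blast
  show "\<forall>k\<in>{1..r}. \<xi> k \<ge> 0"
    unfolding eq[symmetric]
    by (auto simp: sum_weight_apply wscale_def positive_root_nonneg intro!: sum_nonneg mult_nonneg_nonneg)
next
  assume nonneg: "\<forall>k\<in>{1..r}. \<xi> k \<ge> 0"
  have inj: "inj_on \<alpha> {1..r}"
    by (rule inj_onI) (metis simple_root_def zero_neq_one)
  \<comment> \<open>the decomposition that uses simple roots only\<close>
  define c where "c = (\<lambda>\<beta>\<in>\<Phi>\<^sup>+ r. if \<beta> \<in> \<alpha> ` {1..r} then nat \<lfloor>\<xi> (the_inv_into {1..r} \<alpha> \<beta>)\<rfloor> else 0)"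
  have "(\<Sum>\<beta>\<in>\<Phi>\<^sup>+ r. real (c \<beta>) \<cdot>\<^sub>w \<beta>) k = \<xi> k" for k
  proof -
    have "(\<Sum>\<beta>\<in>\<Phi>\<^sup>+ r. real (c \<beta>) \<cdot>\<^sub>w \<beta>) k = (\<Sum>\<beta>\<in>\<Phi>\<^sup>+ r. real (c \<beta>) * \<beta> k)"
      by (simp add: sum_weight_apply wscale_def)
    also have "\<dots> = (\<Sum>\<beta>\<in>\<alpha> ` {1..r}. real (c \<beta>) * \<beta> k)"
      by (rule sum.mono_neutral_right)
         (use simple_root_positive in \<open>auto simp: c_def finite_positive_roots\<close>)
    also have "\<dots> = (\<Sum>i=1..r. real (c (\<alpha> i)) * \<alpha> i k)"
      by (subst sum.reindex[OF inj]) simp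
    also have "\<dots> = (\<Sum>i=1..r. if i = k then \<xi> k else 0)"
    proof (rule sum.cong[OF refl])
      fix i assume i: "i \<in> {1..r}"
      have "real (nat \<lfloor>\<xi> i\<rfloor>) = \<xi> i"
        using int[of i] nonneg i by (auto elim!: Ints_cases)
      then have "real (c (\<alpha> i)) = \<xi> i"
        using i by (simp add: c_def simple_root_positive the_inv_into_f_f[OF inj] del: One_nat_def)
      then show "real (c (\<alpha> i)) * \<alpha> i k = (if i = k then \<xi> k else 0)"
        by (simp add: simple_root_def)
    qed
    also have "\<dots> = \<xi> k"
      using \<xi> by (auto simp: weight_space_def)
    finally show ?thesis .
  qed
  then have "c \<in> {c \<in> \<Phi>\<^sup>+ r \<rightarrow>\<^sub>E UNIV. (\<Sum>\<beta>\<in>\<Phi>\<^sup>+ r. real (c \<beta>) \<cdot>\<^sub>w \<beta>) = \<xi>}"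
    by (auto simp: c_def)
  then show "\<wp> r \<xi> > 0"
    unfolding kostant_partition_def card_gt_0_iff using finite_kostant_decompositions by blast
qed

section \<open>The alternation set of the highest root\<close>

text \<open>
  These are the numbers \<open>0, 2, 3, \<dots>, r, r + 2\<close>: adding the highest root to \<open>\<rho>\<close> changes only the first
  and the last difference of coordinates, by \<open>1\<close> and \<open>-1\<close>.
\<close>

definition shifted_index :: "nat \<Rightarrow> nat \<Rightarrow> nat" where
  "shifted_index r i = (if i = 1 then 0 else if i = Suc r then Suc (Suc r) else i)"

lemma eps_coord_highest_root_plus_weyl_vector:
  assumes "r \<ge> 1" "j \<in> {1..Suc r}"
  shows "eps_coord ((\<Sum>i=1..r. \<alpha> i) + \<rho> r) j = real r / 2 + 1 - real (shifted_index r j)"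
proof -
  have "eps_coord ((\<Sum>i=1..r. \<alpha> i) + \<rho> r) j = eps_coord (\<Sum>i=1..r. \<alpha> i) j + eps_coord (\<rho> r) j"
    by (simp add: eps_coord_def)
  also have "eps_coord (\<Sum>i=1..r. \<alpha> i) j = real j - real (shifted_index r j)"
    using assms unfolding eps_coord_def root_coordinates shifted_index_def by auto
  finally show ?thesis unfolding eps_coord_weyl_vector[OF assms(2)] by linarith
qed

lemma prefix_from_2:
  "k \<ge> 1 \<Longrightarrow> (\<Sum>j=1..k. f j) = f 1 + (\<Sum>j=2..<Suc k. f j :: nat)"
  by (simp add: sum.atLeast_Suc_atMost atLeastLessThanSuc_atLeastAtMost numeral_2_eq_2)

text \<open>
  The conditions for \<open>k = 1\<close> and \<open>k = r\<close> fix the two ends \<open>1\<close> and \<open>r + 1\<close>. In between the first value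
  \<open>0\<close> faces the number \<open>1\<close> on the right-hand side, which is where the slack of \<open>1\<close> comes from.
\<close>

lemma dominated_prefix_sums_iff:
  assumes r: "r \<ge> 2" and p: "p permutes {1..Suc r}"
  shows "(\<forall>k\<in>{1..r}. (\<Sum>j=1..k. shifted_index r (p j)) \<le> (\<Sum>j=1..k. j)) \<longleftrightarrow> p \<in> slack_perms 2 (Suc r)"
    (is "?dom \<longleftrightarrow> _")
proof -
  have prefix: "(\<Sum>j=1..k. shifted_index r (p j)) = (\<Sum>j=2..<Suc k. p j)"
    if p2: "p permutes {2..<Suc r}" and k: "k \<in> {1..r}" for k
  proof -
    have "p 1 = 1" using p2 by (simp add: permutes_def)
    moreover have "(\<Sum>j=2..<Suc k. shifted_index r (p j)) = (\<Sum>j=2..<Suc k. p j)"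
    proof (rule sum.cong[OF refl])
      fix j assume "j \<in> {2..<Suc k}"
      then show "shifted_index r (p j) = p j"
        using permutes_in_image[OF p2, of j] k by (auto simp: shifted_index_def)
    qed
    moreover have "(\<Sum>j=1..k. shifted_index r (p j))
        = shifted_index r (p 1) + (\<Sum>j=2..<Suc k. shifted_index r (p j))"
      using k by (intro prefix_from_2) simp
    ultimately show ?thesis by (simp add: shifted_index_def)
  qed
  show ?thesis
  proof
    assume dom: ?dom
    have "shifted_index r (p 1) \<le> 1"
      using bspec[OF dom, of 1] r by simp
    moreover have "p 1 \<ge> 1" using permutes_in_image[OF p, of 1] by simp
    ultimately have p1: "p 1 = 1" by (auto simp: shifted_index_def split: if_splits)
    have "(\<Sum>j=1..Suc r. shifted_index r (p j)) = (\<Sum>j=1..Suc r. shifted_index r j)"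
      using sum.permute[OF p, of "shifted_index r"] by (simp add: o_def)
    also have "\<dots> = (\<Sum>j=2..<Suc r. shifted_index r j) + Suc (Suc r)"
      using r prefix_from_2[of r "shifted_index r"] by (simp add: shifted_index_def)
    also have "(\<Sum>j=2..<Suc r. shifted_index r j) = (\<Sum>j=2..<Suc r. j)"
      by (rule sum.cong) (auto simp: shifted_index_def)
    also have "Suc (\<Sum>j=2..<Suc r. j) = (\<Sum>j=1..r. j)"
      using r prefix_from_2[of r "\<lambda>j. j"] by simp
    then have "(\<Sum>j=2..<Suc r. j) + Suc (Suc r) = (\<Sum>j=1..r. j) + Suc r" by simp
    finally have "shifted_index r (p (Suc r)) \<ge> Suc r"
      using bspec[OF dom, of r] r by simp
    moreover have "p (Suc r) \<in> {1..Suc r}" using permutes_in_image[OF p, of "Suc r"] by simp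
    ultimately have pr: "p (Suc r) = Suc r"
      by (auto simp: shifted_index_def split: if_splits)
    have p2: "p permutes {2..<Suc r}"
    proof (rule permutes_superset[OF p])
      fix x assume "x \<in> {1..Suc r} - {2..<Suc r}"
      then have "x = 1 \<or> x = Suc r" by auto
      then show "p x = x" using p1 pr by auto
    qed
    have "(\<Sum>j=2..<k. p j) \<le> Suc (\<Sum>j=2..<k. j)" for k
    proof -
      consider "k \<le> 1" | l where "k = Suc l" "l \<in> {1..r}" | "Suc r \<le> k"
        by (cases k) fastforce+
      then show ?thesis
      proof cases
        case 1 then show ?thesis by simp
      next
        case 2
        then show ?thesis
          using bspec[OF dom, of l] prefix[OF p2, of l] prefix_from_2[of l "\<lambda>j. j"] by simp
      next
        case 3
        then show ?thesis using sum_permuted_prefix[OF p2, of k "\<lambda>x. x"] by simp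
      qed
    qed
    with p2 show "p \<in> slack_perms 2 (Suc r)" by (simp add: slack_perms_def)
  next
    assume "p \<in> slack_perms 2 (Suc r)"
    then have p2: "p permutes {2..<Suc r}" and slack: "(\<Sum>j=2..<Suc k. p j) \<le> Suc (\<Sum>j=2..<Suc k. j)" for k
      by (simp_all only: slack_perms_def mem_Collect_eq)
    show ?dom
    proof
      fix k assume k: "k \<in> {1..r}"
      then have "(\<Sum>j=1..k. j) = Suc (\<Sum>j=2..<Suc k. j)"
        using prefix_from_2[of k "\<lambda>j. j"] by simp
      then show "(\<Sum>j=1..k. shifted_index r (p j)) \<le> (\<Sum>j=1..k. j)"
        using prefix[OF p2 k] slack[of k] by simp
    qed
  qed
qed

lemma perm_action_alternation_iff:
  fixes r :: nat
  defines "lam \<equiv> \<Sum>i=1..r. \<alpha> i"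
  assumes r: "r \<ge> 2" and p: "p permutes {1..Suc r}"
  shows "\<wp> r (perm_action r p (lam + \<rho> r) - (0 + \<rho> r)) > 0 \<longleftrightarrow> p \<in> slack_perms 2 (Suc r)"
proof -
  let ?\<xi> = "perm_action r p (lam + \<rho> r) - (0 + \<rho> r)"
  have v: "lam + \<rho> r \<in> weight_space r"
    using weyl_vector_weight_space by (auto simp: lam_def weight_space_def root_coordinates)
  have \<xi>: "?\<xi> \<in> weight_space r"
    using perm_action_closed[OF p v] weyl_vector_weight_space by (auto simp: weight_space_def)
  have coord: "?\<xi> k = real (\<Sum>j=1..k. j) - real (\<Sum>j=1..k. shifted_index r (p j))"
    if k: "k \<in> {1..r}" for k
  proof -
    have "?\<xi> k = (\<Sum>j=1..k. eps_coord (lam + \<rho> r) (p j)) - (\<Sum>j=1..k. eps_coord (\<rho> r) j)"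
      using v sum_eps_coord[OF weyl_vector_weight_space] by (simp add: perm_action_def)
    also have "\<dots> = (\<Sum>j=1..k. real j - real (shifted_index r (p j)))"
      unfolding sum_subtractf[symmetric]
    proof (rule sum.cong[OF refl])
      fix j assume "j \<in> {1..k}"
      then have "j \<in> {1..Suc r}" "p j \<in> {1..Suc r}"
        using k permutes_in_image[OF p, of j] by auto
      then show "eps_coord (lam + \<rho> r) (p j) - eps_coord (\<rho> r) j = real j - real (shifted_index r (p j))"
        using r by (simp add: lam_def eps_coord_highest_root_plus_weyl_vector eps_coord_weyl_vector
            del: atLeastAtMost_iff One_nat_def)
    qed
    finally show ?thesis by (simp add: sum_subtractf)
  qed
  have "?\<xi> k \<in> \<int>" for k
    using coord[of k] \<xi> by (cases "k \<in> {1..r}") (auto simp: weight_space_def simp del: of_nat_sum)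
  then have "\<wp> r ?\<xi> > 0 \<longleftrightarrow> (\<forall>k\<in>{1..r}. ?\<xi> k \<ge> 0)"
    by (rule kostant_partition_pos_iff[OF \<xi>])
  also have "\<dots> \<longleftrightarrow> (\<forall>k\<in>{1..r}. (\<Sum>j=1..k. shifted_index r (p j)) \<le> (\<Sum>j=1..k. j))"
    by (rule ball_cong[OF refl]) (simp only: coord diff_ge_0_iff_ge of_nat_le_iff)
  finally show ?thesis using dominated_prefix_sums_iff[OF r p] by simp
qed

text \<open>
  The Weyl vector is regular: its differences of coordinates are pairwise distinct, so its image
  determines the permutation.
\<close>

lemma inj_on_perm_action: "inj_on (perm_action r) {p. p permutes {1..Suc r}}"
proof (rule inj_onI)
  fix p q assume "p \<in> {p. p permutes {1..Suc r}}" "q \<in> {p. p permutes {1..Suc r}}"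
    and eq: "perm_action r p = perm_action r q"
  then have p: "p permutes {1..Suc r}" and q: "q permutes {1..Suc r}" by auto
  show "p = q"
  proof
    fix j
    show "p j = q j"
    proof (cases "j \<in> {1..Suc r}")
      case True
      then have "eps_coord (\<rho> r) (p j) = eps_coord (\<rho> r) (q j)"
        using eps_coord_perm_action[OF weyl_vector_weight_space, of j] eq by (metis atLeastAtMost_iff)
      moreover have "p j \<in> {1..Suc r}" "q j \<in> {1..Suc r}"
        using True permutes_in_image[OF p, of j] permutes_in_image[OF q, of j] by auto
      ultimately show ?thesis by (simp add: eps_coord_weyl_vector del: atLeastAtMost_iff)
    next
      case False
      then show ?thesis using p q by (metis permutes_not_in)
    qed
  qed
qed

theorem corollary1p1:
  fixes r :: nat and lam :: weight
  assumes "r \<ge> 2"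
    and "lam = (\<Sum>i=1..r. \<alpha> i)"
  shows "card (\<A> r lam 0) = fib r"
proof -
  let ?P = "slack_perms 2 (Suc r)"
  have P: "?P = slack_perms 2 (2 + (r - 1))" using assms(1) by simp
  have perm: "p permutes {1..Suc r}" if "p \<in> ?P" for p
    by (rule slack_perms_permutes[OF that]) simp_all
  have "\<A> r lam 0 = perm_action r ` ?P"
  proof
    show "\<A> r lam 0 \<subseteq> perm_action r ` ?P"
    proof
      fix \<sigma> assume \<sigma>: "\<sigma> \<in> \<A> r lam 0"
      then obtain p where p: "p permutes {1..Suc r}" "\<sigma> = perm_action r p"
        using weyl_group_imp_perm_action unfolding weyl_alternation_set_def by blast
      then show "\<sigma> \<in> perm_action r ` ?P"
        using \<sigma> perm_action_alternation_iff[OF assms(1) p(1)]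
        unfolding weyl_alternation_set_def assms(2) by blast
    qed
    show "perm_action r ` ?P \<subseteq> \<A> r lam 0"
    proof (rule image_subsetI)
      fix p assume p: "p \<in> ?P"
      then have "perm_action r p \<in> weyl_group r"
        using assms(1) by (intro slack_perms_weyl_group[of p 2 "r - 1"]) (simp_all add: P[symmetric])
      then show "perm_action r p \<in> \<A> r lam 0"
        using perm_action_alternation_iff[OF assms(1) perm[OF p]] p
        unfolding weyl_alternation_set_def assms(2) by blast
    qed
  qed
  moreover have "inj_on (perm_action r) ?P"
    by (rule inj_on_subset[OF inj_on_perm_action]) (use perm in auto)
  ultimately have "card (\<A> r lam 0) = card ?P"
    by (simp add: card_image)
  also have "\<dots> = fib r"
    unfolding P card_slack_perms using assms(1) by simp
  finally show ?thesis .
qed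

end
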